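(* Let $p,q$ be distinct primes, and let $k>1$, $m>2$ and $\lambda\ge 1$ be integers. Then there does not exist a $(pq,m,k,\lambda)$-SEDF (over any abelian group of order $pq$).
   Context: Let $G$ be a finite abelian group of order $n$, written multiplicatively, with identity $e$. For nonempty subsets $A_1,A_2\subseteq G$, let $\Delta_E(A_1,A_2)$ be the multiset $\{xy^{-1} : x\in A_1,\ y\in A_2\}$. Let $k,\lambda,m$ be positive integers. An $(n,m,k,\lambda)$-strong external difference family (SEDF) over $G$ is a collection $\{A_1,\dots,A_m\}$ of pairwise disjoint $k$-element subsets of $G$ such that for each $1\le j\le m$ the multiset union $\bigcup_{\ell\neq j}\Delta_E(A_\ell,A_j)$ equals $\lambda(G\setminus\{e\})$, i.e. contains every non-identity element of $G$ exactly $\lambda$ times and does not contain $e$. *)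

theory Defs
  imports
    "HOL-Algebra.Group"
    "HOL-Algebra.Coset"
    "HOL-Library.Multiset"
    "HOL-Library.Disjoint_Sets"
    "HOL-Computational_Algebra.Primes"
begin

definition ext_diff :: "('a, 'b) monoid_scheme \<Rightarrow> 'a set \<Rightarrow> 'a set \<Rightarrow> 'a multiset" where
  "ext_diff G X Y = {# x \<otimes>\<^bsub>G\<^esub> inv\<^bsub>G\<^esub> y. (x, y) \<in># mset_set (X \<times> Y) #}"

(* The collection is an indexed family A 1, ..., A m; as its members are nonempty (k > 0) and
   pairwise disjoint, they are distinct. The multiset union adds multiplicities, so it is the
   sum of multisets. *)
definition is_SEDF ::
  "('a, 'b) monoid_scheme \<Rightarrow> nat \<Rightarrow> nat \<Rightarrow> nat \<Rightarrow> nat \<Rightarrow> (nat \<Rightarrow> 'a set) \<Rightarrow> bool" where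
  "is_SEDF G n m k l A \<longleftrightarrow>
     comm_group G \<and> finite (carrier G) \<and> order G = n \<and>
     m > 0 \<and> k > 0 \<and> l > 0 \<and>
     (\<forall>i\<in>{1..m}. A i \<subseteq> carrier G \<and> card (A i) = k) \<and>
     disjoint_family_on A {1..m} \<and>
     (\<forall>j\<in>{1..m}. (\<Sum>i\<in>{1..m} - {j}. ext_diff G (A i) (A j)) =
        repeat_mset l (mset_set (carrier G - {\<one>\<^bsub>G\<^esub>})))"

end

theory Submission
  imports
    Defs
    "HOL-Algebra.Multiplicative_Group"
    "HOL-Algebra.Sylow"
    "HOL-Analysis.Analysis"
    "HOL-Computational_Algebra.Computational_Algebra"
    "HOL-Number_Theory.Cong"
begin

text \<open>Let \<open>D\<close> be the union of the \<open>A\<^sub>j\<close>. For a nontrivial character \<open>\<psi>\<close> the SEDF condition reads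
  \<open>(\<psi>(D) - \<psi>(A\<^sub>j)) cnj \<psi>(A\<^sub>j) = -\<lambda>\<close>. If \<open>\<psi>(D) \<noteq> 0\<close>, then every \<open>\<psi>(A\<^sub>j)\<close> is a rational multiple
  \<open>t\<^sub>j \<psi>(D)\<close>, and at least two of the \<open>t\<^sub>j\<close> equal the same negative number \<open>t\<close>.

  Identify the group with \<open>Z/p \<times> Z/q\<close>. Since the cyclotomic polynomials are irreducible, a rational
  function on the group killed by a faithful character is a sum of a function of the first and one of the
  second coordinate. Applied to \<open>1\<^sub>D\<close> if \<open>\<psi>(D) = 0\<close>, and otherwise to \<open>1\<^bsub>A\<^esub> - t 1\<^sub>D\<close> for the two sets
  \<open>A\<close> with negative ratio, which would have a common point if \<open>D\<close> depended on both coordinates, this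
  shows that \<open>D\<close> depends on one coordinate only. Projecting to that coordinate, a
  character of prime order and a negative ratio leave only \<open>D = {}\<close> and \<open>D = G\<close>, and the latter is
  excluded by counting.\<close>


section \<open>Evaluation of integer polynomials at complex numbers\<close>

abbreviation int_eval :: "int poly \<Rightarrow> complex \<Rightarrow> complex" where
  "int_eval f z \<equiv> poly (map_poly of_int f) z"

lemma int_eval_add: "int_eval (f + g) z = int_eval f z + int_eval g z"
proof -
  have "map_poly complex_of_int (f + g) = map_poly of_int f + map_poly of_int g"
    by (intro poly_eqI) (simp add: coeff_map_poly)
  then show ?thesis by simp
qed

lemma int_eval_diff: "int_eval (f - g) z = int_eval f z - int_eval g z"
proof -
  have "map_poly complex_of_int (f - g) = map_poly of_int f - map_poly of_int g"
    by (intro poly_eqI) (simp add: coeff_map_poly)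
  then show ?thesis by simp
qed

lemma int_eval_mult: "int_eval (f * g) z = int_eval f z * int_eval g z"
proof -
  have "map_poly complex_of_int (f * g) = map_poly of_int f * map_poly of_int g"
    by (intro poly_eqI) (simp add: coeff_map_poly coeff_mult)
  then show ?thesis by simp
qed

lemma int_eval_const: "int_eval [:c:] z = of_int c"
  by (simp add: map_poly_pCons)

lemma int_eval_smult: "int_eval (smult c f) z = of_int c * int_eval f z"
  using int_eval_mult[of "[:c:]" f z] by (simp add: int_eval_const)

lemma int_eval_pCons: "int_eval (pCons c f) z = of_int c + z * int_eval f z"
  by (simp add: map_poly_pCons)

lemma int_eval_power: "int_eval (f ^ k) z = int_eval f z ^ k"
  by (induction k) (simp_all add: int_eval_mult one_pCons int_eval_const)

lemma int_eval_monom: "int_eval (monom c k) z = of_int c * z ^ k"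
  by (simp add: map_poly_monom poly_monom)

lemma int_eval_sum: "int_eval (sum f S) z = (\<Sum>i\<in>S. int_eval (f i) z)"
  by (induction S rule: infinite_finite_induct) (simp_all add: int_eval_add)

lemma int_eval_pcompose_monom: "int_eval (pcompose f (monom 1 l)) z = int_eval f (z ^ l)"
proof (induction f)
  case (pCons c f)
  then show ?case
    by (simp add: pcompose_pCons int_eval_pCons int_eval_add int_eval_mult int_eval_monom
        int_eval_const del: pCons_0_0 poly_pCons)
qed simp

section \<open>The Frobenius congruence modulo a prime\<close>

text \<open>A prime divides every inner binomial coefficient of its own row. The general ring allows
  use for integers and for integer polynomials.\<close>

lemma prime_dvd_freshman_dream:
  fixes a b :: "'a :: comm_ring_1"
  assumes "prime l"
  shows "of_nat l dvd (a + b) ^ l - a ^ l - b ^ l"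
proof -
  have l: "l > 0" using assms prime_gt_0_nat by blast
  have "(a + b) ^ l = (\<Sum>k\<le>l. of_nat (l choose k) * a ^ k * b ^ (l - k))"
    by (rule binomial_ring)
  also have "{..l} = insert 0 (insert l {1..<l})" using l by auto
  also have "(\<Sum>k\<in>insert 0 (insert l {1..<l}). of_nat (l choose k) * a ^ k * b ^ (l - k))
      = b ^ l + (a ^ l + (\<Sum>k\<in>{1..<l}. of_nat (l choose k) * a ^ k * b ^ (l - k)))"
    using l by simp
  finally have eq: "(a + b) ^ l - a ^ l - b ^ l
      = (\<Sum>k\<in>{1..<l}. of_nat (l choose k) * a ^ k * b ^ (l - k))" by simp
  have "of_nat l dvd (of_nat (l choose k) :: 'a)" if "k \<in> {1..<l}" for k
  proof -
    have "l dvd l choose k" using that assms by (intro dvd_choose_prime) auto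
    then show ?thesis by (elim dvdE) simp
  qed
  then show ?thesis unfolding eq
    by (intro dvd_sum) (simp add: mult.assoc)
qed

lemma prime_dvd_int_power_diff:
  fixes c :: int
  assumes "prime l"
  shows "int l dvd c ^ l - c"
proof -
  have l: "l > 0" using assms prime_gt_0_nat by blast
  have fd: "int l dvd (a + b) ^ l - a ^ l - b ^ l" for a b
    using prime_dvd_freshman_dream[OF assms, of a b] by simp
  have nn: "int l dvd int c ^ l - int c" for c
  proof (induction c)
    case 0
    then show ?case using l by (simp add: power_0_left)
  next
    case (Suc c)
    have "int (Suc c) ^ l - int (Suc c)
        = ((1 + int c) ^ l - 1 ^ l - int c ^ l) + (int c ^ l - int c)" by simp
    then show ?case using Suc fd by (metis dvd_add)
  qed
  show ?thesis
  proof (cases "c \<ge> 0")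
    case True
    then show ?thesis using nn[of "nat c"] by simp
  next
    case False
    \<comment> \<open>Passing from \<open>c\<close> to \<open>-c\<close> through the freshman dream
      for \<open>c + (-c) = 0\<close> avoids a split on the parity of \<open>l\<close>.\<close>
    have "c ^ l - c = - ((c + (- c)) ^ l - c ^ l - (- c) ^ l) - ((- c) ^ l - (- c))"
      using l by (simp add: power_0_left)
    moreover have "int l dvd (- c) ^ l - (- c)" using nn[of "nat (- c)"] False by simp
    ultimately show ?thesis using fd[of c "- c"] by (metis dvd_diff dvd_minus_iff)
  qed
qed

text \<open>Horner induction: constants obey Fermat's little theorem, a factor \<open>x\<close>
  becomes \<open>x ^ l\<close> on both sides, and the freshman dream joins the two.\<close>

lemma frobenius_int_poly:
  assumes "prime l"
  shows "of_nat l dvd f ^ l - pcompose f (monom 1 l :: int poly)"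
proof (induction f)
  case 0
  then show ?case using assms prime_gt_0_nat[of l] by (simp add: power_0_left)
next
  case (pCons c f)
  define x :: "int poly" where "x = monom 1 1"
  have eq: "pCons c f = [:c:] + x * f" by (simp add: x_def monom_altdef)
  have eq2: "pcompose (pCons c f) (monom 1 l) = [:c:] + x ^ l * pcompose f (monom 1 l)"
    by (simp add: pcompose_pCons x_def monom_power)
  have 1: "of_nat l dvd ([:c:] + x * f) ^ l - [:c:] ^ l - (x * f) ^ l"
    by (rule prime_dvd_freshman_dream[OF assms])
  have 2: "of_nat l dvd [:c:] ^ l - [:c:]"
  proof -
    have "[:c:] ^ l - [:c:] = [:c ^ l - c:]" by (simp add: poly_const_pow)
    moreover obtain d where "c ^ l - c = int l * d"
      using prime_dvd_int_power_diff[OF assms, of c] by (elim dvdE)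
    ultimately have "[:c:] ^ l - [:c:] = of_nat l * [:d:]" by (simp add: of_nat_poly)
    then show ?thesis by (rule dvdI)
  qed
  have 3: "of_nat l dvd x ^ l * (f ^ l - pcompose f (monom 1 l))"
    using pCons.IH by simp
  have "(pCons c f) ^ l - pcompose (pCons c f) (monom 1 l)
      = (([:c:] + x * f) ^ l - [:c:] ^ l - (x * f) ^ l) + ([:c:] ^ l - [:c:])
        + x ^ l * (f ^ l - pcompose f (monom 1 l))"
    unfolding eq2 unfolding eq by (simp add: power_mult_distrib algebra_simps)
  then show ?case using 1 2 3 by (metis dvd_add)
qed

section \<open>Minimal polynomials and conjugates of roots of unity\<close>

text \<open>A primitive polynomial of least degree works: pseudo-division stays inside Z[X],
  minimality kills the remainder, and Gauss's lemma removes the scalar that pseudo-division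
  introduces.\<close>

lemma int_minimal_poly_exists:
  fixes z :: complex
  assumes "F \<noteq> 0" "int_eval F z = 0"
  obtains f where "f \<noteq> 0" "int_eval f z = 0" "\<And>g. int_eval g z = 0 \<Longrightarrow> f dvd g"
proof -
  define N where "N = (LEAST d. \<exists>f. f \<noteq> 0 \<and> int_eval f z = 0 \<and> degree f = d)"
  have "\<exists>f. f \<noteq> 0 \<and> int_eval f z = 0 \<and> degree f = N"
    unfolding N_def by (rule LeastI_ex) (use assms in auto)
  then obtain f0 where f0: "f0 \<noteq> 0" "int_eval f0 z = 0" "degree f0 = N" by auto
  have min: "N \<le> degree g" if "g \<noteq> 0" "int_eval g z = 0" for g
    unfolding N_def by (rule Least_le) (use that in auto)
  define f where "f = primitive_part f0"
  have ff: "f0 = smult (Polynomial.content f0) f"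
    unfolding f_def by simp
  have f: "f \<noteq> 0" "int_eval f z = 0" "degree f = N" "Polynomial.content f = 1"
  proof -
    show "f \<noteq> 0" using f0 ff by auto
    show "int_eval f z = 0" using f0(1,2) ff by (metis int_eval_smult mult_eq_0_iff of_int_eq_0_iff smult_eq_0_iff)
    show "degree f = N" using f0 by (simp add: f_def)
    show "Polynomial.content f = 1" using f0 by (simp add: f_def)
  qed
  have "f dvd g" if g: "int_eval g z = 0" for g
  proof -
    obtain a q where aq: "a \<noteq> 0" "smult a g = f * q + pseudo_mod g f"
      using pseudo_mod(1)[OF f(1)] by blast
    have "int_eval (pseudo_mod g f) z = int_eval (smult a g) z - int_eval (f * q) z"
      unfolding aq(2) by (simp add: int_eval_add)
    also have "\<dots> = 0" by (simp add: int_eval_smult int_eval_mult g f)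
    finally have "pseudo_mod g f = 0"
      using min[of "pseudo_mod g f"] pseudo_mod(2)[OF f(1), of g] f(3) by fastforce
    with aq have "f dvd smult a g" by simp
    \<comment> \<open>Over the fraction field the nonzero \<open>a\<close> is a unit; content 1 of
      \<open>f\<close> then carries divisibility back to Z[X].\<close>
    then have "map_poly to_fract f dvd map_poly to_fract (smult a g)"
      by (rule fract_poly_dvd)
    then have "map_poly to_fract f dvd smult (to_fract a) (map_poly to_fract g)" by simp
    then have "map_poly to_fract f dvd map_poly to_fract g"
      by (rule dvd_smult_cancel) (use aq in simp)
    then show ?thesis using f(4) by (rule fract_poly_dvdD)
  qed
  then show ?thesis using that f by blast
qed

text \<open>Division by a monic polynomial in Horner form: after multiplication by \<open>X\<close>
  only the coefficient at \<open>degree f\<close> can be in the way, and a multiple of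
  \<open>f\<close> removes it.\<close>

lemma int_eval_reduce_degree:
  assumes "int_eval f z = 0" "lead_coeff f = 1" "degree f > 0"
  shows "\<exists>r. degree r < degree f \<and> int_eval r z = int_eval s z"
proof (induction s)
  case 0
  then show ?case using assms by (intro exI[of _ 0]) auto
next
  case (pCons c s)
  then obtain r where r: "degree r < degree f" "int_eval r z = int_eval s z" by blast
  define r' where "r' = pCons c r - smult (coeff (pCons c r) (degree f)) f"
  have "degree r' < degree f"
  proof (rule degree_lessI)
    show "r' \<noteq> 0 \<or> 0 < degree f" using assms by simp
    have "degree (pCons c r) \<le> degree f" using r(1) degree_pCons_le[of c r] by linarith
    then show "\<forall>i\<ge>degree f. coeff r' i = 0"
      using assms(2) by (auto simp: r'_def le_less coeff_eq_0)
  qed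
  moreover have "int_eval r' z = int_eval (pCons c s) z"
    by (simp only: r'_def int_eval_diff int_eval_smult assms(1) int_eval_pCons r(2)) simp
  ultimately show ?case by blast
qed

text \<open>Dedekind's argument for the irreducibility of cyclotomic polynomials: the discriminant
  of \<open>X\<^sup>n - 1\<close> is only divisible by primes dividing \<open>n\<close>.\<close>
lemma int_eval_root_of_unity_power_prime:
  fixes w :: complex
  assumes "w ^ n = 1" "n > 0" "prime l" "\<not> l dvd n" "int_eval F w = 0"
  shows "int_eval F (w ^ l) = 0"
proof -
  define X where "X = (monom 1 n - 1 :: int poly)"
  have Xev: "int_eval X z = z ^ n - 1" for z
    using int_eval_const[of 1 z] by (simp add: X_def int_eval_diff int_eval_monom one_pCons)
  have cX: "coeff X n = 1" using assms(2) by (simp add: X_def)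
  then have "X \<noteq> 0" by auto
  have dX: "degree X = n"
  proof (rule antisym)
    show "degree X \<le> n" unfolding X_def
      by (intro degree_diff_le) (simp_all add: degree_monom_le)
    show "n \<le> degree X" using cX by (intro le_degree) simp
  qed
  obtain f0 where f0: "f0 \<noteq> 0" "int_eval f0 w = 0" "\<And>g. int_eval g w = 0 \<Longrightarrow> f0 dvd g"
    using int_minimal_poly_exists[OF \<open>X \<noteq> 0\<close>, of w] assms(1) Xev by auto
  have "f0 dvd X" using f0(3) Xev assms(1) by simp
  \<comment> \<open>\<open>X\<close> is monic, so the leading coefficient of \<open>f0\<close> is 1
    or -1; multiplying by it makes \<open>f0\<close> monic.\<close>
  then have "lead_coeff f0 dvd 1"
    using cX dX by (metis dvd_def lead_coeff_mult)
  then have lcu: "lead_coeff f0 * lead_coeff f0 = 1"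
    by (auto simp: zdvd1_eq abs_if split: if_splits)
  define f where "f = smult (lead_coeff f0) f0"
  have f: "int_eval f w = 0" "lead_coeff f = 1"
    using f0(1,2) lcu by (simp_all add: f_def int_eval_smult)
  have fdvd: "f dvd g" if g: "int_eval g w = 0" for g
  proof -
    obtain h where "g = f0 * h" using f0(3)[OF g] by (elim dvdE)
    then have "g = f * smult (lead_coeff f0) h" using lcu by (simp add: f_def)
    then show ?thesis by (rule dvdI)
  qed
  have fpos: "degree f > 0"
  proof (rule ccontr)
    assume "\<not> ?thesis"
    then obtain c where c: "f = [:c:]" by (metis degree_eq_zeroE gr0I)
    then show False using f by (simp add: int_eval_const)
  qed
  obtain h where h: "X = f * h" using fdvd[of X] Xev assms(1) by (auto elim: dvdE)
  have "int_eval f (w ^ l) = 0"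
  proof (rule ccontr)
    assume nz: "int_eval f (w ^ l) \<noteq> 0"
    have "(w ^ l) ^ n = 1" using assms(1) by (metis power_mult mult.commute power_one)
    then have "int_eval f (w ^ l) * int_eval h (w ^ l) = 0"
      using Xev[of "w ^ l"] by (simp add: h int_eval_mult)
    with nz have "int_eval h (w ^ l) = 0" by simp
    \<comment> \<open>As \<open>h\<close> vanishes at \<open>w ^ l\<close>, the Frobenius congruence
      makes \<open>h(w) ^ l\<close> a multiple of \<open>l\<close> in Z[w].\<close>
    moreover obtain r where "h ^ l - pcompose h (monom 1 l) = of_nat l * r"
      using frobenius_int_poly[OF assms(3)] by (metis dvd_def)
    then have "int_eval (h ^ l - pcompose h (monom 1 l)) w = int_eval ([:int l:] * r) w"
      by (simp add: of_nat_poly)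
    ultimately have hl: "int_eval h w ^ l = of_nat l * int_eval r w"
      by (simp add: int_eval_diff int_eval_power int_eval_pcompose_monom int_eval_mult int_eval_const
          del: mult_pCons_left)
    \<comment> \<open>Differentiating \<open>X = f * h\<close> at \<open>w\<close>, where
      \<open>f\<close> vanishes, shows that \<open>h(w)\<close> divides \<open>n\<close> in Z[w];
      hence \<open>l\<close> divides \<open>n ^ l\<close> there.\<close>
    have "pderiv X = f * pderiv h + h * pderiv f" by (simp add: h pderiv_mult)
    moreover have "pderiv X = monom (int n) (n - 1)" by (simp add: X_def pderiv_diff pderiv_monom)
    ultimately have "int_eval (monom (int n) (n - 1)) w = int_eval (f * pderiv h + h * pderiv f) w"
      by simp
    then have "of_nat n * w ^ (n - 1) = int_eval h w * int_eval (pderiv f) w"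
      by (simp add: int_eval_monom int_eval_add int_eval_mult f)
    then have "of_nat n * w ^ (n - 1) * w = int_eval h w * int_eval (pderiv f) w * w" by simp
    moreover have "w ^ (n - 1) * w = 1" using assms(1,2) by (metis power_minus_mult)
    ultimately have "of_nat n = int_eval h w * (int_eval (pderiv f) w * w)"
      by (metis mult.assoc mult.right_neutral)
    then have nl: "of_nat n ^ l = of_nat l * (int_eval r w * (int_eval (pderiv f) w * w) ^ l)"
      by (simp add: power_mult_distrib hl mult.assoc)
    define s where "s = r * (pderiv f * monom 1 1) ^ l"
    have sev: "of_nat n ^ l = of_nat l * int_eval s w"
      unfolding nl s_def by (simp only: int_eval_mult int_eval_power int_eval_monom) simp
    obtain t where t: "degree t < degree f" "int_eval t w = int_eval s w"
      using int_eval_reduce_degree[OF f fpos] by blast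
    \<comment> \<open>Descent from Z[w] to the integers: \<open>u\<close> vanishes at
      \<open>w\<close> and has smaller degree than \<open>f\<close>, so it is zero; its constant
      coefficient then shows that \<open>l\<close> divides \<open>n ^ l\<close>.\<close>
    define u where "u = smult (int l) t - [:int n ^ l:]"
    have "int_eval u w = 0"
      by (simp only: u_def int_eval_diff int_eval_smult int_eval_const t(2)) (simp add: sev)
    then have "f dvd u" by (rule fdvd)
    moreover have "degree u < degree f" unfolding u_def
      by (intro degree_diff_less) (use t fpos in auto)
    ultimately have "u = 0" by (metis dvd_imp_degree_le leD)
    then have "coeff u 0 = 0" by simp
    then have "int l dvd int (n ^ l)" by (simp add: u_def) (metis dvd_triv_left)
    then have "l dvd n ^ l" by (simp only: int_dvd_int_iff)
    then show False using assms(3,4) prime_dvd_power by blast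
  qed
  moreover obtain g where "F = f * g" using fdvd[OF assms(5)] by (elim dvdE)
  ultimately show ?thesis by (simp add: int_eval_mult)
qed

text \<open>Prime factors of \<open>r\<close> are peeled off one at a time; none divides
  \<open>n\<close>. Each step replaces \<open>w\<close> by \<open>w ^ l\<close>, which is why
  \<open>w\<close> is arbitrary in the induction.\<close>

lemma int_eval_root_of_unity_power_coprime:
  fixes w :: complex
  assumes "w ^ n = 1" "n > 0" "int_eval F w = 0" "coprime r n"
  shows "int_eval F (w ^ r) = 0"
  using assms
proof (induction r arbitrary: w rule: prime_divisors_induct)
  case zero
  \<comment> \<open>Coprimality of 0 and \<open>n\<close> forces \<open>n = 1\<close> and hence
    \<open>w = 1\<close>.\<close>
  then show ?case by simp
next
  case (unit x)
  then show ?case by simp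
next
  case (factor l x)
  have "\<not> l dvd n" using factor.hyps factor.prems(4)
    by (metis coprime_common_divisor_nat coprime_mult_left_iff dvd_refl not_prime_1)
  then have "int_eval F (w ^ l) = 0"
    by (intro int_eval_root_of_unity_power_prime[OF factor.prems(1,2) factor.hyps _ factor.prems(3)])
  moreover have "(w ^ l) ^ n = 1" using factor.prems(1) by (metis power_mult mult.commute power_one)
  moreover have "coprime x n" using factor.prems(4) by simp
  ultimately have "int_eval F ((w ^ l) ^ x) = 0" using factor.IH factor.prems(2) by blast
  then show ?case by (simp add: power_mult)
qed

section \<open>Roots of unity, Fourier inversion and vanishing sums\<close>

abbreviation zeta :: "nat \<Rightarrow> complex" where
  "zeta n \<equiv> exp (2 * complex_of_real pi * \<i> / complex_of_nat n)"

lemma zeta_power_eq_1_iff: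
  assumes "n > 0"
  shows "zeta n ^ j = 1 \<longleftrightarrow> n dvd j"
proof -
  have "zeta n ^ j = exp (2 * complex_of_real pi * \<i> * complex_of_nat j / complex_of_nat n)"
    by (simp add: exp_of_nat_mult[symmetric] mult_ac)
  then show ?thesis using complex_root_unity_eq_1[of n j] assms by simp
qed

lemma zeta_power_mod:
  assumes "n > 0" "[i = j] (mod n)"
  shows "zeta n ^ i = zeta n ^ j"
proof -
  have "zeta n ^ i = zeta n ^ (i mod n)" for i
  proof -
    have "zeta n ^ i = zeta n ^ (n * (i div n) + i mod n)" by simp
    also have "\<dots> = (zeta n ^ n) ^ (i div n) * zeta n ^ (i mod n)"
      by (simp only: power_add power_mult)
    also have "zeta n ^ n = 1" using zeta_power_eq_1_iff[OF assms(1)] by simp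
    finally show ?thesis by simp
  qed
  then show ?thesis using assms(2) by (metis cong_def)
qed

lemma zeta_mult_power:
  assumes "p > 0" "q > 0"
  shows "zeta (p * q) ^ q = zeta p"
  using assms by (simp add: exp_of_nat_mult[symmetric])

lemma norm_zeta_power: "norm (zeta n ^ j) = 1"
  by (simp add: norm_power norm_exp_eq_Re)

lemma sum_powers_root_of_unity:
  fixes z :: complex
  assumes "z ^ n = 1" "z \<noteq> 1"
  shows "(\<Sum>a<n. z ^ a) = 0"
  using geometric_sum[OF assms(2), of n] assms(1) by simp

text \<open>Fourier inversion on Z/p: with only the trivial coefficient left,
  \<open>p * c x0\<close> equals the sum of all \<open>c x\<close>, whatever \<open>x0\<close>
  is.\<close>

lemma const_if_nontrivial_fourier_coeffs_zero:
  fixes c :: "nat \<Rightarrow> complex"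
  assumes "\<And>a. a \<in> {1..<p} \<Longrightarrow> (\<Sum>x<p. c x * zeta p ^ (a * x)) = 0" "x < p" "x' < p"
  shows "c x = c x'"
proof -
  have p: "p > 0" using assms(2) by simp
  have "of_nat p * c x0 = (\<Sum>x<p. c x)" if x0: "x0 < p" for x0
  proof -
    \<comment> \<open>Orthogonality of characters; the exponent \<open>x + p - x0\<close> stands for
      \<open>x - x0\<close> modulo \<open>p\<close> without leaving the natural numbers.\<close>
    have inner: "(\<Sum>a<p. zeta p ^ (a * (x + p - x0))) = (if x = x0 then of_nat p else 0)"
      if "x < p" for x
    proof (cases "x = x0")
      case True
      have "zeta p ^ (a * p) = 1" for a using zeta_power_eq_1_iff[OF p] by simp
      then show ?thesis using True by simp
    next
      case False
      have "\<not> p dvd x + p - x0"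
      proof
        assume "p dvd x + p - x0"
        then obtain k where k: "x + p - x0 = p * k" by (elim dvdE)
        have "x + p - x0 > 0" using x0 by simp
        then have "k \<noteq> 0" using k by (metis mult_0_right less_irrefl)
        moreover have "k \<noteq> 1" using k x0 that False by auto
        ultimately have "p * 2 \<le> p * k" by simp
        then show False using k that x0 by linarith
      qed
      then have "zeta p ^ (x + p - x0) \<noteq> 1" using zeta_power_eq_1_iff[OF p] by simp
      moreover have "(zeta p ^ (x + p - x0)) ^ p = 1"
        using zeta_power_eq_1_iff[OF p, of "(x + p - x0) * p"] by (simp add: power_mult)
      ultimately have "(\<Sum>a<p. (zeta p ^ (x + p - x0)) ^ a) = 0"
        by (intro sum_powers_root_of_unity)
      then show ?thesis using False by (simp add: power_mult[symmetric] mult.commute)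
    qed
    have "(\<Sum>a<p. zeta p ^ (a * (p - x0)) * (\<Sum>x<p. c x * zeta p ^ (a * x)))
        = (\<Sum>a<p. \<Sum>x<p. c x * zeta p ^ (a * (x + p - x0)))"
    proof (intro sum.cong refl)
      fix a
      have "zeta p ^ (a * (p - x0)) * (c x * zeta p ^ (a * x)) = c x * zeta p ^ (a * (x + p - x0))" for x
      proof -
        have "x + p - x0 = (p - x0) + x" using x0 by simp
        then show ?thesis by (simp add: distrib_left power_add)
      qed
      then show "zeta p ^ (a * (p - x0)) * (\<Sum>x<p. c x * zeta p ^ (a * x))
          = (\<Sum>x<p. c x * zeta p ^ (a * (x + p - x0)))" by (simp only: sum_distrib_left)
    qed
    also have "\<dots> = (\<Sum>x<p. c x * (\<Sum>a<p. zeta p ^ (a * (x + p - x0))))"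
      by (subst sum.swap) (simp add: sum_distrib_left)
    also have "\<dots> = (\<Sum>x<p. c x * (if x = x0 then of_nat p else 0))"
      by (intro sum.cong refl) (simp add: inner)
    also have "\<dots> = of_nat p * c x0" using x0 by (simp add: if_distrib mult.commute cong: if_cong)
    finally have "of_nat p * c x0
        = (\<Sum>a<p. zeta p ^ (a * (p - x0)) * (\<Sum>x<p. c x * zeta p ^ (a * x)))" by simp
    also have "\<dots> = (\<Sum>a\<in>{0}. zeta p ^ (a * (p - x0)) * (\<Sum>x<p. c x * zeta p ^ (a * x)))"
      by (rule sum.mono_neutral_right) (use p assms(1) in auto)
    finally show ?thesis by simp
  qed
  from this[OF assms(2)] this[OF assms(3)] have "of_nat p * c x = of_nat p * c x'" by simp
  then show ?thesis using p by simp
qed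

text \<open>For \<open>0 < a < q\<close> the number \<open>zeta q ^ a\<close> is a conjugate of
  \<open>zeta q\<close>, so the relation holds there too and Fourier inversion applies.\<close>

lemma vanishing_sum_prime:
  fixes f :: "nat \<Rightarrow> int"
  assumes "prime q" "(\<Sum>y<q. of_int (f y) * zeta q ^ y) = 0" "y < q" "y' < q"
  shows "f y = f y'"
proof -
  have q: "q > 0" using assms(3) by simp
  define F where "F = (\<Sum>y<q. monom (f y) y)"
  have Fev: "int_eval F z = (\<Sum>y<q. of_int (f y) * z ^ y)" for z
    by (simp add: F_def int_eval_sum int_eval_monom)
  have z1: "zeta q ^ q = 1" using zeta_power_eq_1_iff[OF q] by simp
  have "(\<Sum>y<q. of_int (f y) * zeta q ^ (a * y)) = 0" if a: "a \<in> {1..<q}" for a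
  proof -
    have "coprime a q" using a assms(1)
      by (metis atLeastLessThan_iff coprime_commute nat_dvd_not_less not_less_eq_eq One_nat_def prime_imp_coprime
          zero_less_Suc not_le)
    then have "int_eval F (zeta q ^ a) = 0"
      by (intro int_eval_root_of_unity_power_coprime[OF z1 q]) (simp_all add: Fev assms(2))
    then show ?thesis by (simp add: Fev power_mult)
  qed
  then have "complex_of_int (f y) = of_int (f y')"
    by (rule const_if_nontrivial_fourier_coeffs_zero) (use assms in auto)
  then show ?thesis by simp
qed

text \<open>Vanishing mixed differences mean that \<open>f\<close> is a function of \<open>x\<close>
  plus a function of \<open>y\<close>. One relation suffices: by the Chinese remainder theorem the
  conjugates of a primitive \<open>pq\<close>-th root realize every pair of nontrivial frequencies,
  and Fourier inversion then acts on one coordinate at a time.\<close>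

lemma vanishing_sum_two_primes:
  fixes f :: "nat \<Rightarrow> nat \<Rightarrow> int"
  assumes "prime p" "prime q" "p \<noteq> q"
    and 0: "(\<Sum>x<p. \<Sum>y<q. of_int (f x y) * (zeta p ^ x * zeta q ^ y)) = 0"
    and xy: "x < p" "x' < p" "y < q" "y' < q"
  shows "f x y - f x' y = f x y' - f x' y'"
proof -
  have pq: "p > 0" "q > 0" "p * q > 0" using xy by auto
  have cop: "coprime p q" using assms(1-3) by (simp add: primes_coprime)
  define w where "w = zeta (p * q)"
  have wq: "w ^ q = zeta p" unfolding w_def by (rule zeta_mult_power[OF pq(1,2)])
  have wp: "w ^ p = zeta q" unfolding w_def mult.commute[of p q] by (rule zeta_mult_power[OF pq(2,1)])
  have w1: "w ^ (p * q) = 1" unfolding w_def using zeta_power_eq_1_iff[OF pq(3)] by simp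
  \<comment> \<open>This exponent turns the double sum into a polynomial in one variable at
    \<open>w\<close>, since \<open>w ^ q = zeta p\<close> and \<open>w ^ p = zeta q\<close>.\<close>
  define F where "F = (\<Sum>x<p. \<Sum>y<q. monom (f x y) (q * x + p * y))"
  have Fev: "int_eval F (w ^ r) = (\<Sum>x<p. \<Sum>y<q. of_int (f x y) * (zeta p ^ (r * x) * zeta q ^ (r * y)))" for r
  proof -
    have "(w ^ r) ^ (q * x + p * y) = zeta p ^ (r * x) * zeta q ^ (r * y)" for x y
      by (simp only: wq[symmetric] wp[symmetric] power_mult[symmetric] power_add[symmetric])
         (simp add: algebra_simps)
    then show ?thesis by (simp add: F_def int_eval_sum int_eval_monom)
  qed
  have ab: "(\<Sum>x<p. \<Sum>y<q. of_int (f x y) * (zeta p ^ (a * x) * zeta q ^ (b * y))) = 0"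
    if a: "a \<in> {1..<p}" and b: "b \<in> {1..<q}" for a b
  proof -
    obtain r where r: "[r = a] (mod p)" "[r = b] (mod q)"
      using binary_chinese_remainder_nat[OF cop] by blast
    have "\<not> p dvd r" using r(1) a by (auto simp: cong_dvd_iff dest: dvd_imp_le)
    then have "coprime r p" using assms(1) by (simp add: prime_imp_coprime coprime_commute)
    moreover have "\<not> q dvd r" using r(2) b by (auto simp: cong_dvd_iff dest: dvd_imp_le)
    then have "coprime r q" using assms(2) by (simp add: prime_imp_coprime coprime_commute)
    ultimately have "coprime r (p * q)" by simp
    moreover have "int_eval F w = 0" using Fev[of 1] 0 by simp
    ultimately have "int_eval F (w ^ r) = 0"
      by (intro int_eval_root_of_unity_power_coprime[OF w1 pq(3)])
    moreover have "zeta p ^ (r * x) = zeta p ^ (a * x)" for x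
      by (intro zeta_power_mod pq cong_mult r cong_refl)
    moreover have "zeta q ^ (r * x) = zeta q ^ (b * x)" for x
      by (intro zeta_power_mod pq cong_mult r cong_refl)
    ultimately show ?thesis by (simp add: Fev)
  qed
  \<comment> \<open>Inversion in the first coordinate, at a fixed nonzero frequency \<open>b\<close>
    in the second.\<close>
  have col: "(\<Sum>y<q. of_int (f x y) * zeta q ^ (b * y)) = (\<Sum>y<q. of_int (f x' y) * zeta q ^ (b * y))"
    if b: "b \<in> {1..<q}" for b
  proof -
    have "(\<Sum>x<p. (\<Sum>y<q. of_int (f x y) * zeta q ^ (b * y)) * zeta p ^ (a * x)) = 0"
      if a: "a \<in> {1..<p}" for a
    proof -
      have "(\<Sum>y<q. of_int (f x y) * zeta q ^ (b * y)) * zeta p ^ (a * x)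
          = (\<Sum>y<q. of_int (f x y) * (zeta p ^ (a * x) * zeta q ^ (b * y)))" for x
        by (subst sum_distrib_right) (simp add: mult_ac)
      then show ?thesis using ab[OF a b] by simp
    qed
    then show ?thesis
      by (rule const_if_nontrivial_fourier_coeffs_zero[where c = "\<lambda>x. \<Sum>y<q. of_int (f x y) * zeta q ^ (b * y)"])
         (use xy in auto)
  qed
  \<comment> \<open>The difference of the rows \<open>x\<close> and \<open>x'\<close> thus has only
    its trivial coefficient left, so it is constant in \<open>y\<close>.\<close>
  have "(\<Sum>y<q. of_int (f x y - f x' y) * zeta q ^ (b * y)) = 0" if "b \<in> {1..<q}" for b
    using col[OF that] by (simp add: left_diff_distrib sum_subtractf)
  then have "complex_of_int (f x y - f x' y) = of_int (f x y' - f x' y')"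
    by (rule const_if_nontrivial_fourier_coeffs_zero) (use xy in auto)
  then show ?thesis by (simp only: of_int_eq_iff)
qed

section \<open>Ratios forced by the character equations\<close>

text \<open>The numbers \<open>\<alpha>\<^sub>j / S\<close> are real roots of \<open>t\<^sup>2 - t = c\<close> with \<open>c = \<lambda> / |S|\<^sup>2 > 0\<close> and sum
  to 1. Since the two roots sum to 1 as well, this forces the negative root to be rational and to
  occur at least twice.\<close>
lemma two_negative_rational_ratios:
  fixes \<alpha> :: "'i \<Rightarrow> complex" and lam :: real
  assumes "finite J" "card J > 2" "lam > 0" "S = (\<Sum>j\<in>J. \<alpha> j)" "S \<noteq> 0"
    and eq: "\<And>j. j \<in> J \<Longrightarrow> (S - \<alpha> j) * cnj (\<alpha> j) = - complex_of_real lam"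
  obtains i j and u w :: int where "i \<in> J" "j \<in> J" "i \<noteq> j" "u < 0" "w > 0"
    "of_int w * \<alpha> i = of_int u * S" "of_int w * \<alpha> j = of_int u * S"
proof -
  define c where "c = lam / (cmod S)\<^sup>2"
  have nS: "cmod S > 0" using assms(5) by simp
  have c: "c > 0" using assms(3) nS by (simp add: c_def)
  \<comment> \<open>Expanding \<open>eq\<close> gives
    \<open>S * cnj (\<alpha> j) = |\<alpha> j|^2 - lam\<close>, so \<open>\<alpha> j / S\<close> is
    this real number.\<close>
  define t where "t j = ((cmod (\<alpha> j))\<^sup>2 - lam) / (cmod S)\<^sup>2" for j
  have \<alpha>: "\<alpha> j = of_real (t j) * S" if "j \<in> J" for j
  proof -
    have "S * cnj (\<alpha> j) = complex_of_real ((cmod (\<alpha> j))\<^sup>2 - lam)"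
      using eq[OF that] complex_norm_square[of "\<alpha> j"] by (simp add: algebra_simps)
    then have "cnj (S * cnj (\<alpha> j)) = cnj (complex_of_real ((cmod (\<alpha> j))\<^sup>2 - lam))" by (rule arg_cong)
    then have "cnj S * \<alpha> j = complex_of_real ((cmod (\<alpha> j))\<^sup>2 - lam)" by (simp only: complex_cnj_mult complex_cnj_cnj complex_cnj_complex_of_real)
    then have "(S * cnj S) * \<alpha> j = complex_of_real ((cmod (\<alpha> j))\<^sup>2 - lam) * S" by (simp add: mult_ac)
    then have "complex_of_real ((cmod S)\<^sup>2) * \<alpha> j = complex_of_real ((cmod (\<alpha> j))\<^sup>2 - lam) * S"
      by (simp only: complex_norm_square)
    then show ?thesis using nS by (simp add: t_def field_simps)
  qed
  have quad: "t j * t j = t j + c" if "j \<in> J" for j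
  proof -
    have "(cmod (\<alpha> j))\<^sup>2 = (t j)\<^sup>2 * (cmod S)\<^sup>2"
      using \<alpha>[OF that] by (simp add: norm_mult power_mult_distrib)
    then have "t j * (cmod S)\<^sup>2 = (t j)\<^sup>2 * (cmod S)\<^sup>2 - lam"
      using nS by (simp add: t_def)
    then have "t j = (t j)\<^sup>2 - c" using nS by (simp add: c_def field_simps)
    then show ?thesis by (simp add: power2_eq_square)
  qed
  have sum1: "(\<Sum>j\<in>J. t j) = 1"
  proof -
    have "S = (\<Sum>j\<in>J. of_real (t j) * S)" using assms(4) \<alpha> by simp
    also have "\<dots> = of_real (\<Sum>j\<in>J. t j) * S" by (simp add: sum_distrib_right)
    finally have "(of_real (\<Sum>j\<in>J. t j) :: complex) = 1" using assms(5) by simp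
    then show ?thesis by (simp only: of_real_eq_1_iff)
  qed
  have sgn: "t j < 0 \<or> t j > 1" if "j \<in> J" for j
  proof (rule ccontr)
    assume "\<not> ?thesis"
    then have "t j * (t j - 1) \<le> 0" by (intro mult_nonneg_nonpos) auto
    then show False using quad[OF that] c by (simp add: algebra_simps)
  qed
  define N where "N = {j \<in> J. t j < 0}"
  have N: "N \<subseteq> J" "finite N" using assms(1) by (auto simp: N_def)
  \<comment> \<open>Without a negative ratio the sum of the ratios would be at least
    \<open>card J\<close>.\<close>
  have "N \<noteq> {}"
  proof
    assume "N = {}"
    then have "t j \<ge> 1" if "j \<in> J" for j using sgn[OF that] that by (auto simp: N_def)
    then have "(\<Sum>j\<in>J. t j) \<ge> (\<Sum>j\<in>J. 1)" by (intro sum_mono) auto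
    then show False using sum1 assms(2) by simp
  qed
  then obtain i where i: "i \<in> N" by blast
  define s where "s = t i"
  have s: "s < 0" using i by (simp add: s_def N_def)
  have roots: "t j = s \<or> t j = 1 - s" if "j \<in> J" for j
  proof -
    have "(t j - s) * (t j + s - 1) = 0"
      using quad[OF that] quad[of i] i N by (auto simp: s_def algebra_simps)
    then show ?thesis by auto
  qed
  have tN: "t j = s" if "j \<in> N" for j using roots[of j] that s by (auto simp: N_def)
  have tN': "t j = 1 - s" if "j \<in> J - N" for j using roots[of j] that s by (auto simp: N_def)
  define b m where "b = int (card N)" and "m = int (card J)"
  have "(\<Sum>j\<in>J. t j) = (\<Sum>j\<in>N. t j) + (\<Sum>j\<in>J - N. t j)"
    using N assms(1) by (metis add.commute sum.subset_diff)
  also have "\<dots> = of_int b * s + of_int (m - b) * (1 - s)"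
    using N assms(1) by (simp add: tN tN' b_def m_def card_Diff_subset card_mono of_nat_diff)
  finally have lin: "s * of_int (2 * b - m) = of_int (1 - m + b)"
    using sum1 by (simp add: algebra_simps)
  have m: "m > 2" using assms(2) by (simp add: m_def)
  \<comment> \<open>With a single negative ratio \<open>lin\<close> reads
    \<open>s * (2 - m) = 2 - m\<close>, which forces \<open>s = 1\<close>.\<close>
  have "b \<noteq> 1"
  proof
    assume "b = 1"
    then have "(s - 1) * of_int (2 - m) = 0" using lin by (simp add: algebra_simps)
    then show False using s m by simp
  qed
  moreover have "b > 0" using i N by (auto simp: b_def card_gt_0_iff)
  ultimately have "card N > 1" by (simp add: b_def)
  then obtain j where j: "j \<in> N" "j \<noteq> i"
    by (metis N(2) One_nat_def card_le_Suc0_iff_eq i not_less)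
  \<comment> \<open>\<open>2 * b = m\<close> would also give \<open>b = m - 1\<close>, hence
    \<open>m = 2\<close>.\<close>
  have ne: "2 * b - m \<noteq> 0"
  proof
    assume z: "2 * b - m = 0"
    then have "(of_int (1 - m + b) :: real) = 0" using lin by simp
    then have "1 - m + b = 0" by (simp only: of_int_eq_0_iff)
    then show False using z m by linarith
  qed
  \<comment> \<open>\<open>lin\<close> expresses \<open>s\<close> as a fraction; the sign of the
    denominator moves into \<open>u\<close> to keep \<open>w\<close> positive.\<close>
  define w u where "w = \<bar>2 * b - m\<bar>" and "u = sgn (2 * b - m) * (1 - m + b)"
  have w: "w > 0" using ne by (simp add: w_def)
  have ws: "of_int w * s = of_int u"
  proof -
    have "of_int w * s = of_int (sgn (2 * b - m)) * (s * of_int (2 * b - m))"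
      by (simp add: w_def abs_sgn[of "2 * b - m"])
    then show ?thesis unfolding lin u_def by simp
  qed
  have "of_int w * s < 0" using w s by (simp add: mult_pos_neg)
  then have u: "u < 0" using ws by simp
  have "of_int w * \<alpha> k = of_int u * S" if "k \<in> N" for k
  proof -
    have "of_int w * \<alpha> k = of_real (of_int w * s) * S" using \<alpha>[of k] tN[OF that] that N by auto
    then show ?thesis unfolding ws by simp
  qed
  then show ?thesis using that[of i j u w] i j N u w by blast
qed

section \<open>Unions of disjoint subsets of the grid\<close>

lemma sum_grid_indicator:
  fixes g :: "nat \<times> nat \<Rightarrow> 'a :: comm_ring_1"
  assumes "B \<subseteq> {..<p} \<times> {..<q}"
  shows "(\<Sum>z\<in>B. g z) = (\<Sum>x<p. \<Sum>y<q. of_bool ((x, y) \<in> B) * g (x, y))"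
proof -
  have "(\<Sum>x<p. \<Sum>y<q. of_bool ((x, y) \<in> B) * g (x, y))
      = (\<Sum>z\<in>{..<p} \<times> {..<q}. of_bool (z \<in> B) * g z)"
    by (subst sum.cartesian_product) (simp only: case_prod_unfold prod.collapse)
  also have "\<dots> = (\<Sum>z\<in>B. of_bool (z \<in> B) * g z)"
    by (rule sum.mono_neutral_right) (use assms in auto)
  finally show ?thesis by simp
qed

text \<open>Supplies the rectangle for the contradictions below: \<open>f\<close> is zero at one
  corner, so its value at the opposite corner \<open>(x, y')\<close> is a sum of two nonzero
  values.\<close>

lemma additive_function_support:
  fixes f :: "nat \<Rightarrow> nat \<Rightarrow> int"
  assumes add: "\<And>x x' y y'. x < p \<Longrightarrow> x' < p \<Longrightarrow> y < q \<Longrightarrow> y' < q \<Longrightarrow> f x y - f x' y = f x y' - f x' y'"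
    and D: "\<And>x y. x < p \<Longrightarrow> y < q \<Longrightarrow> (x, y) \<in> D \<longleftrightarrow> f x y \<noteq> 0"
    and "\<not> (\<forall>x<p. \<forall>x'<p. \<forall>y<q. (x, y) \<in> D \<longleftrightarrow> (x', y) \<in> D)"
    and "\<not> (\<forall>x<p. \<forall>y<q. \<forall>y'<q. (x, y) \<in> D \<longleftrightarrow> (x, y') \<in> D)"
  obtains x x' y y' where "x < p" "x' < p" "y < q" "y' < q"
    "(x, y) \<in> D" "(x', y') \<in> D" "(x', y) \<notin> D" "f x y' = f x y + f x' y'"
proof -
  obtain x x' y where 1: "x < p" "x' < p" "y < q" "(x, y) \<in> D" "(x', y) \<notin> D"
    using assms(3) by blast
  obtain a b b' where 2: "a < p" "b < q" "b' < q" "(a, b) \<in> D" "(a, b') \<notin> D"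
    using assms(4) by blast
  \<comment> \<open>If \<open>f\<close> vanished at both \<open>(x', b)\<close> and
    \<open>(x', b')\<close>, additivity would give \<open>f a b = f a b'\<close>, although only the
    latter is zero.\<close>
  have "f a b - f x' b = f a b' - f x' b'" using add 1 2 by blast
  moreover have "f a b \<noteq> 0" "f a b' = 0" using D 2 by blast+
  ultimately have "f x' b \<noteq> 0 \<or> f x' b' \<noteq> 0" by linarith
  then obtain y' where 3: "y' < q" "(x', y') \<in> D" using D 1 2 by blast
  have "f x y - f x' y = f x y' - f x' y'" using add 1 3 by blast
  moreover have "f x' y = 0" using D 1 by blast
  ultimately have "f x y' = f x y + f x' y'" by linarith
  then show ?thesis using that 1 3 by blast
qed

text \<open>The additive function takes too few values. An indicator never equals
  \<open>1 + 1\<close>. The function \<open>f k\<close> is at least \<open>-u\<close> on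
  \<open>D\<close> but at most \<open>-u\<close> off \<open>B k\<close>, so a corner with value at
  least \<open>-2u\<close> lies in \<open>B k\<close>; this places \<open>(x, y')\<close> in two
  disjoint sets.\<close>

lemma union_independent_of_coordinate:
  fixes B :: "'i \<Rightarrow> (nat \<times> nat) set" and lam :: real
  assumes pq: "prime p" "prime q" "p \<noteq> q"
    and J: "finite J" "card J > 2" and lam: "lam > 0"
    and B: "\<And>j. j \<in> J \<Longrightarrow> B j \<subseteq> {..<p} \<times> {..<q}" "disjoint_family_on B J"
    and D: "D = (\<Union>j\<in>J. B j)"
    and g: "g = (\<lambda>(x, y). zeta p ^ x * zeta q ^ y)"
    and eq: "\<And>j. j \<in> J \<Longrightarrow> (sum g D - sum g (B j)) * cnj (sum g (B j)) = - complex_of_real lam"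
  shows "(\<forall>x<p. \<forall>x'<p. \<forall>y<q. (x, y) \<in> D \<longleftrightarrow> (x', y) \<in> D) \<or>
         (\<forall>x<p. \<forall>y<q. \<forall>y'<q. (x, y) \<in> D \<longleftrightarrow> (x, y') \<in> D)"
proof (rule ccontr)
  assume "\<not> ?thesis"
  then have contr:
    "\<not> (\<forall>x<p. \<forall>x'<p. \<forall>y<q. (x, y) \<in> D \<longleftrightarrow> (x', y) \<in> D)"
    "\<not> (\<forall>x<p. \<forall>y<q. \<forall>y'<q. (x, y) \<in> D \<longleftrightarrow> (x, y') \<in> D)" by blast+
  have Dsub: "D \<subseteq> {..<p} \<times> {..<q}" using B D by blast
  have fin: "finite (B j)" if "j \<in> J" for j using B(1)[OF that] by (rule finite_subset) simp
  have sumD: "sum g D = (\<Sum>j\<in>J. sum g (B j))"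
    unfolding D by (rule sum.UNION_disjoint) (use J fin B(2) in \<open>auto simp: disjoint_family_on_def\<close>)
  have ind: "sum g X = (\<Sum>x<p. \<Sum>y<q. of_bool ((x, y) \<in> X) * (zeta p ^ x * zeta q ^ y))"
    if "X \<subseteq> {..<p} \<times> {..<q}" for X
    using sum_grid_indicator[OF that, of g] by (simp add: g)
  show False
  proof (cases "sum g D = 0")
    case True
    define f :: "nat \<Rightarrow> nat \<Rightarrow> int" where "f x y = of_bool ((x, y) \<in> D)" for x y
    have 0: "(\<Sum>x<p. \<Sum>y<q. of_int (f x y) * (zeta p ^ x * zeta q ^ y)) = 0"
      using True ind[OF Dsub] by (simp add: f_def)
    have add: "f x y - f x' y = f x y' - f x' y'"
      if "x < p" "x' < p" "y < q" "y' < q" for x x' y y'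
      by (rule vanishing_sum_two_primes[OF pq 0 that])
    have fD: "(x, y) \<in> D \<longleftrightarrow> f x y \<noteq> 0" for x y by (simp add: f_def)
    obtain x x' y y' where "(x, y) \<in> D" "(x', y') \<in> D" "f x y' = f x y + f x' y'"
      by (rule additive_function_support[OF add fD contr])
    then show False by (cases "(x, y') \<in> D") (simp_all add: f_def)
  next
    case False
    obtain i j and u w :: int where ij: "i \<in> J" "j \<in> J" "i \<noteq> j" and uw: "u < 0" "w > 0"
      and ui: "of_int w * sum g (B i) = of_int u * sum g D"
      and uj: "of_int w * sum g (B j) = of_int u * sum g D"
      by (rule two_negative_rational_ratios[OF J lam sumD False eq])
    define f where "f k x y = w * of_bool ((x, y) \<in> B k) - u * of_bool ((x, y) \<in> D)" for k x y
    have add: "f k x y - f k x' y = f k x y' - f k x' y'"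
      if k: "k \<in> {i, j}" and xy: "x < p" "x' < p" "y < q" "y' < q" for k x x' y y'
    proof (rule vanishing_sum_two_primes[OF pq _ xy])
      have "k \<in> J" using k ij by blast
      have "(\<Sum>x<p. \<Sum>y<q. of_int (f k x y) * (zeta p ^ x * zeta q ^ y))
          = of_int w * sum g (B k) - of_int u * sum g D"
        unfolding ind[OF Dsub] ind[OF B(1)[OF \<open>k \<in> J\<close>]]
        by (simp only: f_def of_int_diff of_int_mult of_int_of_bool left_diff_distrib sum_subtractf
            sum_distrib_left mult.assoc)
      also have "\<dots> = 0" using k ui uj by auto
      finally show "(\<Sum>x<p. \<Sum>y<q. of_int (f k x y) * (zeta p ^ x * zeta q ^ y)) = 0" .
    qed
    have BD: "B k \<subseteq> D" if "k \<in> {i, j}" for k using that ij D by blast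
    have fD: "(x, y) \<in> D \<longleftrightarrow> f k x y \<noteq> 0" if "k \<in> {i, j}" for k x y
      using BD[OF that] uw by (auto simp: f_def)
    have fpos: "f k x y \<ge> - u" if "k \<in> {i, j}" "(x, y) \<in> D" for k x y
      using that uw by (auto simp: f_def)
    \<comment> \<open>The corner conditions mention only \<open>D\<close>, so the rectangle found
      with \<open>f i\<close> serves \<open>f j\<close> as well.\<close>
    obtain x x' y y' where xy: "x < p" "x' < p" "y < q" "y' < q"
      "(x, y) \<in> D" "(x', y') \<in> D" "(x', y) \<notin> D"
      by (rule additive_function_support[OF add[of i] fD[of i] contr]) simp_all
    have "(x, y') \<in> B k" if k: "k \<in> {i, j}" for k
    proof (rule ccontr)
      assume "(x, y') \<notin> B k"
      then have "f k x y' \<le> - u" using uw by (auto simp: f_def)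
      moreover have "f k x y - f k x' y = f k x y' - f k x' y'" using add[OF k] xy by blast
      moreover have "f k x' y = 0" using fD[OF k] xy by blast
      moreover have "f k x y \<ge> - u" "f k x' y' \<ge> - u" using fpos[OF k] xy by blast+
      ultimately show False using uw by linarith
    qed
    then have "(x, y') \<in> B i \<inter> B j" by blast
    then show False using ij B(2) by (metis disjoint_family_onD empty_iff)
  qed
qed

text \<open>As \<open>g\<close> ignores \<open>x\<close>, its sum over a set weighs each
  \<open>y\<close> by the number of points above it. The vanishing sum over \<open>q\<close>-th
  roots of unity then makes these counts, or a combination of them, constant in
  \<open>y\<close>.\<close>

lemma union_trivial_if_independent_of_fst:
  fixes B :: "'i \<Rightarrow> (nat \<times> nat) set" and lam :: real
  assumes q: "prime q" and p: "p > 0"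
    and J: "finite J" "card J > 2" and lam: "lam > 0"
    and B: "\<And>j. j \<in> J \<Longrightarrow> B j \<subseteq> {..<p} \<times> {..<q}" "disjoint_family_on B J"
    and D: "D = (\<Union>j\<in>J. B j)"
    and g: "g = (\<lambda>(x, y). zeta q ^ y)"
    and eq: "\<And>j. j \<in> J \<Longrightarrow> (sum g D - sum g (B j)) * cnj (sum g (B j)) = - complex_of_real lam"
    and indep: "\<forall>x<p. \<forall>x'<p. \<forall>y<q. (x, y) \<in> D \<longleftrightarrow> (x', y) \<in> D"
  shows "D = {} \<or> D = {..<p} \<times> {..<q}"
proof -
  have Dsub: "D \<subseteq> {..<p} \<times> {..<q}" using B D by blast
  have fin: "finite (B j)" if "j \<in> J" for j using B(1)[OF that] by (rule finite_subset) simp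
  have sumD: "sum g D = (\<Sum>j\<in>J. sum g (B j))"
    unfolding D by (rule sum.UNION_disjoint) (use J fin B(2) in \<open>auto simp: disjoint_family_on_def\<close>)
  have ind: "sum g X = (\<Sum>y<q. of_int (\<Sum>x<p. of_bool ((x, y) \<in> X)) * zeta q ^ y)"
    if "X \<subseteq> {..<p} \<times> {..<q}" for X
  proof -
    have "sum g X = (\<Sum>x<p. \<Sum>y<q. of_bool ((x, y) \<in> X) * zeta q ^ y)"
      using sum_grid_indicator[OF that, of g] by (simp add: g)
    also have "\<dots> = (\<Sum>y<q. of_int (\<Sum>x<p. of_bool ((x, y) \<in> X)) * zeta q ^ y)"
      by (subst sum.swap) (simp add: sum_distrib_right)
    finally show ?thesis .
  qed
  have colD: "(\<Sum>x<p. of_bool ((x, y) \<in> D)) = int p * of_bool ((0, y) \<in> D)" if "y < q" for y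
  proof -
    have "(\<Sum>x<p. of_bool ((x, y) \<in> D) :: int) = (\<Sum>x<p. of_bool ((0, y) \<in> D))"
    proof (rule sum.cong[OF refl])
      fix x assume "x \<in> {..<p}"
      then have "(x, y) \<in> D \<longleftrightarrow> (0, y) \<in> D" using indep p that by blast
      then show "(of_bool ((x, y) \<in> D) :: int) = of_bool ((0, y) \<in> D)" by simp
    qed
    then show ?thesis by simp
  qed
  \<comment> \<open>By \<open>indep\<close> the points of \<open>D\<close> with \<open>x = 0\<close>
    determine all of \<open>D\<close>.\<close>
  have triv: ?thesis if const: "\<And>y y'. y < q \<Longrightarrow> y' < q \<Longrightarrow> (0, y) \<in> D \<longleftrightarrow> (0, y') \<in> D"
  proof (cases "D = {}")
    case False
    then obtain x y where xy: "(x, y) \<in> D" "x < p" "y < q" using Dsub by auto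
    have "(x', y') \<in> D" if "x' < p" "y' < q" for x' y'
      using xy that const indep p by metis
    then show ?thesis using Dsub by auto
  qed simp
  show ?thesis
  proof (cases "sum g D = 0")
    case True
    then have 0: "(\<Sum>y<q. of_int (\<Sum>x<p. of_bool ((x, y) \<in> D)) * zeta q ^ y) = 0"
      using ind[OF Dsub] by simp
    show ?thesis
    proof (rule triv)
      fix y y' assume y: "y < q" "y' < q"
      have "(\<Sum>x<p. of_bool ((x, y) \<in> D) :: int) = (\<Sum>x<p. of_bool ((x, y') \<in> D))"
        by (rule vanishing_sum_prime[OF q 0 y])
      then have "int p * of_bool ((0, y) \<in> D) = int p * of_bool ((0, y') \<in> D)"
        by (simp only: colD y)
      then show "(0, y) \<in> D \<longleftrightarrow> (0, y') \<in> D" using p by (auto simp: of_bool_def split: if_splits)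
    qed
  next
    case False
    obtain j and u w :: int where j: "j \<in> J" and uw: "u < 0" "w > 0"
      and uj: "of_int w * sum g (B j) = of_int u * sum g D"
      by (rule two_negative_rational_ratios[OF J lam sumD False eq])
    define f where "f y = w * (\<Sum>x<p. of_bool ((x, y) \<in> B j)) - u * (\<Sum>x<p. of_bool ((x, y) \<in> D))" for y
    have 0: "(\<Sum>y<q. of_int (f y) * zeta q ^ y) = 0"
    proof -
      have lin: "(\<Sum>y<q. of_int (w * a y - u * b y) * zeta q ^ y)
          = of_int w * (\<Sum>y<q. of_int (a y) * zeta q ^ y) - of_int u * (\<Sum>y<q. of_int (b y) * zeta q ^ y)"
        for a b
        by (simp only: of_int_diff of_int_mult left_diff_distrib sum_subtractf sum_distrib_left mult.assoc)
      have "(\<Sum>y<q. of_int (f y) * zeta q ^ y) = of_int w * sum g (B j) - of_int u * sum g D"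
        unfolding ind[OF Dsub] ind[OF B(1)[OF j]] f_def by (rule lin)
      then show ?thesis using uj by simp
    qed
    \<comment> \<open>Both terms of \<open>f y\<close> are nonnegative because \<open>u < 0\<close>,
      so nothing cancels.\<close>
    have f0: "f y = 0 \<longleftrightarrow> (0, y) \<notin> D" if "y < q" for y
    proof
      assume "(0, y) \<notin> D"
      then have "(x, y) \<notin> D" if "x < p" for x using that indep p \<open>y < q\<close> by blast
      moreover have "B j \<subseteq> D" using D j by blast
      ultimately show "f y = 0" unfolding f_def by (auto intro!: sum.neutral)
    next
      assume fy: "f y = 0"
      have "w * (\<Sum>x<p. of_bool ((x, y) \<in> B j)) \<ge> 0" using uw by (intro mult_nonneg_nonneg sum_nonneg) auto
      then have "- u * (int p * of_bool ((0, y) \<in> D)) \<le> 0" using fy colD[OF that] by (simp add: f_def)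
      then show "(0, y) \<notin> D" using uw p by (auto simp: mult_le_0_iff zero_le_mult_iff)
    qed
    show ?thesis
    proof (rule triv)
      fix y y' assume y: "y < q" "y' < q"
      have "f y = f y'" by (rule vanishing_sum_prime[OF q 0 y])
      then show "(0, y) \<in> D \<longleftrightarrow> (0, y') \<in> D" using f0 y by metis
    qed
  qed
qed

section \<open>Coordinates and characters of an abelian group of order \<open>p * q\<close>\<close>

text \<open>Sylow's theorem with exponent 1 yields a subgroup of order \<open>p\<close>; its
  elements other than the identity have an order that divides \<open>p\<close> and is not 1.\<close>

lemma (in group) prime_order_element_exists:
  assumes "finite (carrier G)" "prime p" "Coset.order G = p * m"
  obtains u where "u \<in> carrier G" "ord u = p"
proof -
  obtain H where H: "subgroup H G" "card H = p"
    using sylow_thm[OF assms(2) is_group, of 1 m] assms(1,3) by auto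
  have "card H > 1" using H assms(2) prime_gt_1_nat by simp
  then obtain u where u: "u \<in> H" "u \<noteq> \<one>"
    by (metis One_nat_def card_le_Suc0_iff_eq card_gt_0_iff not_less less_trans zero_less_one)
  have uG: "u \<in> carrier G" using u H by (meson subgroup.mem_carrier)
  have "u [^]\<^bsub>G\<lparr>carrier := H\<rparr>\<^esub> p = \<one>\<^bsub>G\<lparr>carrier := H\<rparr>\<^esub>"
    using group.pow_order_eq_1[OF subgroup.subgroup_is_group[OF H(1) is_group], of u] u H(2)
    by (simp add: Coset.order_def)
  then have "u [^] p = \<one>" using nat_pow_consistent[of u p H] by simp
  then have "ord u dvd p" using pow_eq_id[OF uG] by blast
  moreover have "ord u \<noteq> 1" using ord_eq_1[OF uG] u by blast
  ultimately show ?thesis using that uG assms(2) by (metis prime_nat_iff)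
qed

lemma (in group) pow_mult_coprime_cancel:
  assumes "u \<in> carrier G" "ord u = p" "coprime p q" "x < p" "x' < p"
    "u [^] (x * q) = u [^] (x' * q)"
  shows "x = x'"
proof -
  have "u [^] int (x * q) = u [^] int (x' * q)" using assms(6) by (simp only: int_pow_int)
  then have "int p dvd int (x' * q) - int (x * q)" using int_pow_eq assms(1,2) by blast
  then have "[x' * q = x * q] (mod p)"
    by (metis cong_iff_dvd_diff cong_int_iff)
  then have "[x' = x] (mod p)" using assms(3) by (metis cong_mult_rcancel_nat coprime_commute)
  then show ?thesis using assms(4,5) by (simp add: cong_def)
qed

text \<open>The \<open>q\<close>-th power removes the \<open>v\<close> part and the
  \<open>p\<close>-th power the \<open>u\<close> part, which gives injectivity; surjectivity follows
  by counting.\<close>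

lemma (in comm_group) coordinates_order_two_primes:
  assumes "finite (carrier G)" "prime p" "prime q" "p \<noteq> q" "Coset.order G = p * q"
  obtains u v where "u \<in> carrier G" "v \<in> carrier G" "ord u = p" "ord v = q"
    "bij_betw (\<lambda>(x, y). u [^] x \<otimes> v [^] y) ({..<p} \<times> {..<q}) (carrier G)"
proof -
  obtain u where u: "u \<in> carrier G" "ord u = p"
    using prime_order_element_exists assms(1,2,5) by blast
  obtain v where v: "v \<in> carrier G" "ord v = q"
    using prime_order_element_exists[OF assms(1,3), of p] assms(5) by (metis mult.commute)
  have cop: "coprime p q" using assms(2-4) by (simp add: primes_coprime)
  let ?E = "\<lambda>(x, y). u [^] x \<otimes> v [^] y"
  have powq: "(u [^] x \<otimes> v [^] y) [^] q = u [^] (x * q)" for x y :: nat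
  proof -
    have "v [^] (y * q) = \<one>" using pow_eq_id[OF v(1)] v(2) by simp
    then show ?thesis using u v by (simp add: nat_pow_distrib nat_pow_pow)
  qed
  have powp: "(u [^] x \<otimes> v [^] y) [^] p = v [^] (y * p)" for x y :: nat
  proof -
    have "u [^] (x * p) = \<one>" using pow_eq_id[OF u(1)] u(2) by simp
    then show ?thesis using u v by (simp add: nat_pow_distrib nat_pow_pow)
  qed
  have inj: "inj_on ?E ({..<p} \<times> {..<q})"
  proof (rule inj_onI)
    fix z z' assume z: "z \<in> {..<p} \<times> {..<q}" "z' \<in> {..<p} \<times> {..<q}" "?E z = ?E z'"
    obtain x y x' y' where zz: "z = (x, y)" "z' = (x', y')" by (cases z, cases z') auto
    have xy: "x < p" "x' < p" "y < q" "y' < q" and eq: "u [^] x \<otimes> v [^] y = u [^] x' \<otimes> v [^] y'"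
      using z zz by auto
    have "u [^] (x * q) = u [^] (x' * q)" using eq powq by metis
    then have "x = x'" using pow_mult_coprime_cancel[OF u cop] xy by blast
    moreover have "v [^] (y * p) = v [^] (y' * p)" using eq powp by metis
    then have "y = y'" using pow_mult_coprime_cancel[OF v] cop xy
      by (metis coprime_commute)
    ultimately show "z = z'" using zz by blast
  qed
  moreover have "?E ` ({..<p} \<times> {..<q}) = carrier G"
  proof (rule card_subset_eq[OF assms(1)])
    show "?E ` ({..<p} \<times> {..<q}) \<subseteq> carrier G" using u v by auto
    show "card (?E ` ({..<p} \<times> {..<q})) = card (carrier G)"
      using assms(5) by (simp add: card_image[OF inj] card_cartesian_product Coset.order_def)
  qed
  ultimately have "bij_betw ?E ({..<p} \<times> {..<q}) (carrier G)" by (simp add: bij_betw_def)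
  then show ?thesis using that u v by blast
qed

text \<open>Norm 1 excludes the zero function and turns inverses into complex conjugates. Values
  outside the carrier are unconstrained.\<close>

definition is_character :: "('a, 'b) monoid_scheme \<Rightarrow> ('a \<Rightarrow> complex) \<Rightarrow> bool" where
  "is_character G \<psi> \<longleftrightarrow> (\<forall>z\<in>carrier G. norm (\<psi> z) = 1 \<and>
     (\<forall>z'\<in>carrier G. \<psi> (z \<otimes>\<^bsub>G\<^esub> z') = \<psi> z * \<psi> z'))"

text \<open>Arbitrary frequencies \<open>a\<close> and \<open>b\<close> provide faithful characters
  as well as those trivial on one factor.\<close>

lemma (in comm_group) characters_order_two_primes:
  assumes "finite (carrier G)" "prime p" "prime q" "p \<noteq> q" "Coset.order G = p * q"
  obtains E where "bij_betw E ({..<p} \<times> {..<q}) (carrier G)"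
    "\<forall>a b. \<exists>\<psi>. is_character G \<psi> \<and>
        (\<forall>x<p. \<forall>y<q. \<psi> (E (x, y)) = zeta p ^ (a * x) * zeta q ^ (b * y))"
proof -
  obtain u v where uv: "u \<in> carrier G" "v \<in> carrier G" "ord u = p" "ord v = q"
    and bij: "bij_betw (\<lambda>(x, y). u [^] x \<otimes> v [^] y) ({..<p} \<times> {..<q}) (carrier G)"
    using coordinates_order_two_primes[OF assms] by metis
  define E where "E = (\<lambda>(x, y). u [^] (x :: nat) \<otimes> v [^] (y :: nat))"
  have bijE: "bij_betw E ({..<p} \<times> {..<q}) (carrier G)" using bij by (simp add: E_def)
  have pq: "p > 0" "q > 0" using assms(2,3) prime_gt_0_nat by auto
  have pow_mod: "w [^] (x mod ord w) = w [^] x" if "w \<in> carrier G" for w and x :: nat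
  proof -
    have "w [^] x = w [^] (ord w * (x div ord w) + x mod ord w)" by simp
    also have "\<dots> = w [^] (ord w * (x div ord w)) \<otimes> w [^] (x mod ord w)"
      using that by (simp only: nat_pow_mult)
    also have "w [^] (ord w * (x div ord w)) = \<one>" using pow_eq_id[OF that] by simp
    finally show ?thesis using that by simp
  qed
  have E_mod: "E (x mod p, y mod q) = E (x, y)" for x y
    using pow_mod[of u x] pow_mod[of v y] uv by (simp add: E_def)
  have E_mult: "E (x, y) \<otimes> E (x', y') = E (x + x', y + y')" for x y x' y'
  proof -
    have "E (x, y) \<otimes> E (x', y') = (u [^] x \<otimes> u [^] x') \<otimes> (v [^] y \<otimes> v [^] y')"
      using uv by (simp add: E_def m_ac)
    then show ?thesis using uv by (simp add: E_def nat_pow_mult)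
  qed
  have "\<exists>\<psi>. is_character G \<psi> \<and>
      (\<forall>x<p. \<forall>y<q. \<psi> (E (x, y)) = zeta p ^ (a * x) * zeta q ^ (b * y))" for a b
  proof -
    define \<psi> where "\<psi> z = (case inv_into ({..<p} \<times> {..<q}) E z of
        (x, y) \<Rightarrow> zeta p ^ (a * x) * zeta q ^ (b * y))" for z
    have chi0: "\<psi> (E (x, y)) = zeta p ^ (a * x) * zeta q ^ (b * y)" if "x < p" "y < q" for x y
      using bij_betw_inv_into_left[OF bijE, of "(x, y)"] that by (simp add: \<psi>_def)
    \<comment> \<open>By periodicity the formula extends from the grid to all exponents, so
      multiplicativity follows from \<open>E_mult\<close> without any reduction.\<close>
    have chi: "\<psi> (E (x, y)) = zeta p ^ (a * x) * zeta q ^ (b * y)" for x y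
    proof -
      have "\<psi> (E (x, y)) = zeta p ^ (a * (x mod p)) * zeta q ^ (b * (y mod q))"
        using chi0[of "x mod p" "y mod q"] pq by (simp add: E_mod)
      also have "zeta p ^ (a * (x mod p)) = zeta p ^ (a * x)"
        by (intro zeta_power_mod pq cong_mult cong_refl) (simp add: cong_def)
      also have "zeta q ^ (b * (y mod q)) = zeta q ^ (b * y)"
        by (intro zeta_power_mod pq cong_mult cong_refl) (simp add: cong_def)
      finally show ?thesis .
    qed
    have surj: "\<exists>x y. z = E (x, y)" if "z \<in> carrier G" for z
      using bijE that by (metis bij_betw_imp_surj_on imageE surj_pair)
    have "is_character G \<psi>"
      unfolding is_character_def
    proof (intro ballI conjI)
      fix z assume "z \<in> carrier G"
      then obtain x y where z: "z = E (x, y)" using surj by blast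
      show "norm (\<psi> z) = 1" unfolding z chi by (simp only: norm_mult norm_zeta_power mult_1)
      fix z' assume "z' \<in> carrier G"
      then obtain x' y' where z': "z' = E (x', y')" using surj by blast
      show "\<psi> (z \<otimes> z') = \<psi> z * \<psi> z'" unfolding z z' E_mult chi
        by (simp only: distrib_left power_add mult_ac)
    qed
    then show ?thesis using chi by blast
  qed
  then have "\<forall>a b. \<exists>\<psi>. is_character G \<psi> \<and>
      (\<forall>x<p. \<forall>y<q. \<psi> (E (x, y)) = zeta p ^ (a * x) * zeta q ^ (b * y))" by (intro allI)
  with bijE show ?thesis by (rule that)
qed

section \<open>Equations satisfied by a strong external difference family\<close>

text \<open>Summation of \<open>\<psi>\<close> over a multiset is additive, and
  \<open>\<psi>\<close> factors on each quotient, so the defining identity of multisets becomes this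
  equation. Keeping the sum over the group on the right covers the trivial character too.\<close>

lemma SEDF_character_equation:
  assumes A: "is_SEDF G n m k l A" and chi: "is_character G \<psi>" and j: "j \<in> {1..m}"
  shows "(\<Sum>i\<in>{1..m} - {j}. sum \<psi> (A i)) * cnj (sum \<psi> (A j)) = of_nat l * (sum \<psi> (carrier G) - 1)"
proof -
  have cg: "comm_group G" and fin: "finite (carrier G)"
    and AG: "\<And>i. i \<in> {1..m} \<Longrightarrow> A i \<subseteq> carrier G"
    and eq: "(\<Sum>i\<in>{1..m} - {j}. ext_diff G (A i) (A j)) = repeat_mset l (mset_set (carrier G - {\<one>\<^bsub>G\<^esub>}))"
    using A j by (auto simp: is_SEDF_def)
  interpret comm_group G by (rule cg)
  have mult: "\<psi> (z \<otimes>\<^bsub>G\<^esub> z') = \<psi> z * \<psi> z'" if "z \<in> carrier G" "z' \<in> carrier G" for z z'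
    using chi that by (simp add: is_character_def)
  have nrm: "norm (\<psi> z) = 1" if "z \<in> carrier G" for z using chi that by (simp add: is_character_def)
  \<comment> \<open>Multiplicativity makes this value idempotent, and norm 1 excludes 0.\<close>
  have one: "\<psi> \<one>\<^bsub>G\<^esub> = 1"
    using mult[of "\<one>\<^bsub>G\<^esub>" "\<one>\<^bsub>G\<^esub>"] nrm[of "\<one>\<^bsub>G\<^esub>"] by auto
  have chi_inv: "\<psi> (inv\<^bsub>G\<^esub> z) = cnj (\<psi> z)" if "z \<in> carrier G" for z
  proof -
    have "\<psi> z * \<psi> (inv\<^bsub>G\<^esub> z) = 1" using mult[of z "inv\<^bsub>G\<^esub> z"] that one by simp
    moreover have "\<psi> z * cnj (\<psi> z) = 1"
      using complex_norm_square[of "\<psi> z"] nrm[OF that] by simp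
    ultimately show ?thesis by (metis mult_cancel_left mult_zero_left zero_neq_one)
  qed
  have finA: "finite (A i)" if "i \<in> {1..m}" for i using AG[OF that] fin finite_subset by blast
  define h where "h M = sum_mset (image_mset \<psi> M)" for M
  have h_sum: "h (\<Sum>i\<in>I. M i) = (\<Sum>i\<in>I. h (M i))" for I :: "nat set" and M
    by (induction I rule: infinite_finite_induct) (simp_all add: h_def)
  have h_repeat: "h (repeat_mset l M) = of_nat l * h M" for l M
    by (induction l) (simp_all add: h_def algebra_simps)
  have h_set: "h (mset_set X) = sum \<psi> X" for X by (simp add: h_def sum_unfold_sum_mset)
  have h_ext: "h (ext_diff G (A i) (A j)) = sum \<psi> (A i) * cnj (sum \<psi> (A j))" if i: "i \<in> {1..m}" for i
  proof -
    have "h (ext_diff G (A i) (A j)) = (\<Sum>(x, y)\<in>A i \<times> A j. \<psi> (x \<otimes>\<^bsub>G\<^esub> inv\<^bsub>G\<^esub> y))"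
      by (simp add: h_def ext_diff_def sum_unfold_sum_mset multiset.map_comp comp_def case_prod_unfold)
    also have "\<dots> = (\<Sum>x\<in>A i. \<Sum>y\<in>A j. \<psi> (x \<otimes>\<^bsub>G\<^esub> inv\<^bsub>G\<^esub> y))"
      by (simp add: sum.cartesian_product)
    also have "\<dots> = (\<Sum>x\<in>A i. \<Sum>y\<in>A j. \<psi> x * cnj (\<psi> y))"
      using AG[OF i] AG[OF j] by (intro sum.cong refl) (auto simp: mult chi_inv subset_iff)
    also have "\<dots> = sum \<psi> (A i) * cnj (sum \<psi> (A j))"
      by (simp add: sum_product)
    finally show ?thesis .
  qed
  have "(\<Sum>i\<in>{1..m} - {j}. sum \<psi> (A i)) * cnj (sum \<psi> (A j))
      = (\<Sum>i\<in>{1..m} - {j}. h (ext_diff G (A i) (A j)))"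
    by (simp add: h_ext sum_distrib_right)
  also have "\<dots> = of_nat l * sum \<psi> (carrier G - {\<one>\<^bsub>G\<^esub>})"
    unfolding h_sum[symmetric] eq h_repeat h_set ..
  also have "sum \<psi> (carrier G - {\<one>\<^bsub>G\<^esub>}) = sum \<psi> (carrier G) - 1"
    using fin one by (simp add: sum_diff1)
  finally show ?thesis .
qed

text \<open>This is the character equation for the trivial character.\<close>

lemma SEDF_parameter_equation:
  assumes "is_SEDF G n m k l A"
  shows "k * k * (m - 1) = l * (n - 1)"
proof -
  have cg: "comm_group G" and fin: "finite (carrier G)" and m: "m > 0" and n: "card (carrier G) = n"
    and Ak: "\<And>i. i \<in> {1..m} \<Longrightarrow> card (A i) = k"
    using assms by (auto simp: is_SEDF_def Coset.order_def)
  interpret comm_group G by (rule cg)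
  have "carrier G \<noteq> {}" using one_closed by blast
  then have n0: "n > 0" using n fin by (metis card_gt_0_iff)
  have "(\<Sum>i\<in>{1..m} - {1}. sum (\<lambda>_. 1 :: complex) (A i)) * cnj (sum (\<lambda>_. 1) (A 1))
      = of_nat l * (sum (\<lambda>_. 1) (carrier G) - 1)"
    by (rule SEDF_character_equation[OF assms]) (use m in \<open>auto simp: is_character_def\<close>)
  then have "complex_of_nat ((m - 1) * k * k) = of_nat (l * (n - 1))"
    using m n n0 by (simp add: Ak of_nat_diff)
  then show ?thesis by (simp only: of_nat_eq_iff mult_ac)
qed

text \<open>A covering means \<open>n = k * m\<close>. Then \<open>k\<close> is coprime to
  \<open>n - 1\<close> and so divides \<open>l\<close>; cancelling it leaves
  \<open>k * (m - 1)\<close> as a positive multiple of \<open>k * m - 1\<close>, which is larger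
  since \<open>k > 1\<close>.\<close>

lemma SEDF_not_covering:
  assumes A: "is_SEDF G n m k l A" and k: "k > 1"
  shows "(\<Union>i\<in>{1..m}. A i) \<noteq> carrier G"
proof
  assume cover: "(\<Union>i\<in>{1..m}. A i) = carrier G"
  have fin: "finite (carrier G)" and m: "m > 0" and n: "card (carrier G) = n" and l: "l > 0"
    and AG: "\<And>i. i \<in> {1..m} \<Longrightarrow> A i \<subseteq> carrier G"
    and Ak: "\<And>i. i \<in> {1..m} \<Longrightarrow> card (A i) = k"
    and disj: "disjoint_family_on A {1..m}"
    using A by (auto simp: is_SEDF_def Coset.order_def)
  have finA: "finite (A i)" if "i \<in> {1..m}" for i using AG[OF that] fin finite_subset by blast
  have "card (\<Union>i\<in>{1..m}. A i) = (\<Sum>i\<in>{1..m}. card (A i))"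
    by (rule card_UN_disjoint) (use finA disj in \<open>auto simp: disjoint_family_on_def\<close>)
  then have nkm: "n = k * m" using cover n Ak by simp
  have eq: "k * k * (m - 1) = l * (k * m - 1)"
    using SEDF_parameter_equation[OF A] nkm by simp
  have "coprime k (k * m - 1)"
    using k m by (intro coprimeI) (metis dvd_diffD1 dvd_mult2 mult_eq_0_iff not_gr0 not_less less_one less_numeral_extra(3) One_nat_def Suc_leI nat_0_less_mult_iff less_trans zero_less_one)
  moreover have "k dvd l * (k * m - 1)" unfolding eq[symmetric] by simp
  ultimately have "k dvd l" by (simp add: coprime_dvd_mult_left_iff)
  then obtain t where t: "l = k * t" by (elim dvdE)
  have "k * (k * (m - 1)) = k * (t * (k * m - 1))" using eq t by (simp add: mult_ac)
  then have "k * (m - 1) = t * (k * m - 1)" using k by simp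
  moreover have "t \<ge> 1" using t l by (cases t) auto
  ultimately have "k * m - 1 \<le> k * (m - 1)" by (metis mult_le_mono1 nat_mult_1)
  then have "k * m - 1 \<le> k * m - k" by (simp add: diff_mult_distrib2)
  moreover have "k \<le> k * m" using m by simp
  ultimately show False using k by linarith
qed

text \<open>The sum is a product of two geometric sums, one of which vanishes.\<close>

lemma sum_grid_character_eq_0:
  assumes "p > 0" "q > 0" "\<not> p dvd a \<or> \<not> q dvd b"
  shows "(\<Sum>(x, y)\<in>{..<p} \<times> {..<q}. zeta p ^ (a * x) * zeta q ^ (b * y)) = 0"
proof -
  have zero: "(\<Sum>x<n. zeta n ^ (c * x)) = 0" if "n > 0" "\<not> n dvd c" for n c
  proof -
    have "(zeta n ^ c) ^ n = 1" using zeta_power_eq_1_iff[OF that(1), of "c * n"] by (simp add: power_mult)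
    moreover have "zeta n ^ c \<noteq> 1" using zeta_power_eq_1_iff[OF that(1)] that(2) by simp
    ultimately show ?thesis using sum_powers_root_of_unity by (simp add: power_mult)
  qed
  have "(\<Sum>(x, y)\<in>{..<p} \<times> {..<q}. zeta p ^ (a * x) * zeta q ^ (b * y))
      = (\<Sum>x<p. zeta p ^ (a * x)) * (\<Sum>y<q. zeta q ^ (b * y))"
    by (simp only: sum_product sum.cartesian_product)
  then show ?thesis using zero assms by auto
qed

section \<open>Transfer to the grid and the final contradiction\<close>

theorem theorem3p9:
  fixes G :: "('a, 'b) monoid_scheme" and p q m k l :: nat
  assumes "prime p" and "prime q" and "p \<noteq> q"
    and "k > 1" and "m > 2" and "l \<ge> 1"
  shows "\<not> (\<exists>A. is_SEDF G (p * q) m k l A)"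
proof
  assume "\<exists>A. is_SEDF G (p * q) m k l A"
  then obtain A where A: "is_SEDF G (p * q) m k l A" by blast
  have cg: "comm_group G" and fin: "finite (carrier G)" and ord: "Coset.order G = p * q"
    and AG: "\<And>i. i \<in> {1..m} \<Longrightarrow> A i \<subseteq> carrier G"
    and Ak: "\<And>i. i \<in> {1..m} \<Longrightarrow> card (A i) = k"
    and disjA: "disjoint_family_on A {1..m}"
    using A by (auto simp: is_SEDF_def)
  have pq: "p > 1" "q > 1" using assms(1,2) prime_gt_1_nat by auto
  define R where "R = {..<p} \<times> {..<q}"
  obtain E where E: "bij_betw E R (carrier G)"
    and chars: "\<forall>a b. \<exists>\<psi>. is_character G \<psi> \<and>
        (\<forall>x<p. \<forall>y<q. \<psi> (E (x, y)) = zeta p ^ (a * x) * zeta q ^ (b * y))"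
    by (rule comm_group.characters_order_two_primes[OF cg fin assms(1-3) ord, folded R_def])
  define J where "J = {1..m}"
  have J: "finite J" "card J > 2" using assms(5) by (simp_all add: J_def)
  \<comment> \<open>The sets are pulled back along \<open>E\<close> so that the grid lemmas
    apply.\<close>
  define B where "B j = {z \<in> R. E z \<in> A j}" for j
  define D where "D = (\<Union>j\<in>J. B j)"
  have BR: "B j \<subseteq> {..<p} \<times> {..<q}" for j by (auto simp: B_def R_def)
  then have finB: "finite (B j)" for j by (rule finite_subset) simp
  have disjB: "disjoint_family_on B J"
    unfolding disjoint_family_on_def
  proof (intro ballI impI)
    fix i j assume "i \<in> J" "j \<in> J" "i \<noteq> j"
    then have "A i \<inter> A j = {}" using disjA by (simp add: disjoint_family_on_def J_def)
    then show "B i \<inter> B j = {}" by (auto simp: B_def)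
  qed
  have EB: "bij_betw E (B j) (A j)" if "j \<in> J" for j
  proof -
    have "A j \<subseteq> E ` R" using AG[of j] that E by (simp add: J_def bij_betw_def)
    then have "E ` B j = A j" by (auto simp: B_def)
    moreover have "inj_on E (B j)"
      by (rule inj_on_subset[of E R]) (use E in \<open>auto simp: bij_betw_def B_def\<close>)
    ultimately show ?thesis by (simp add: bij_betw_def)
  qed
  have lam: "real l > 0" using assms(6) by simp
  \<comment> \<open>General frequencies are allowed because three choices follow:
    \<open>(1, 1)\<close>, \<open>(0, 1)\<close> and \<open>(1, 0)\<close>. For each the sum over
    the group is 0, which leaves \<open>-l\<close>.\<close>
  have eq: "(sum g D - sum g (B j)) * cnj (sum g (B j)) = - complex_of_real (real l)"
    if g: "g = (\<lambda>(x, y). zeta p ^ (a * x) * zeta q ^ (b * y))"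
      and ab: "\<not> p dvd a \<or> \<not> q dvd b" and j: "j \<in> J" for g a b j
  proof -
    obtain \<psi> where psi: "is_character G \<psi>"
      "\<And>x y. x < p \<Longrightarrow> y < q \<Longrightarrow> \<psi> (E (x, y)) = zeta p ^ (a * x) * zeta q ^ (b * y)"
      using chars[rule_format, of a b] by blast
    have psiE: "\<psi> (E z) = g z" if "z \<in> R" for z
      using that psi(2) by (auto simp: R_def g)
    have sumA: "sum \<psi> (A i) = sum g (B i)" if "i \<in> J" for i
    proof -
      have "sum \<psi> (A i) = (\<Sum>z\<in>B i. \<psi> (E z))"
        by (rule sum.reindex_bij_betw[OF EB[OF that], symmetric])
      also have "\<dots> = sum g (B i)" by (intro sum.cong refl psiE) (simp add: B_def)
      finally show ?thesis .
    qed
    have "sum \<psi> (carrier G) = (\<Sum>z\<in>R. \<psi> (E z))"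
      by (rule sum.reindex_bij_betw[OF E, symmetric])
    also have "\<dots> = sum g R" by (intro sum.cong refl psiE)
    also have "\<dots> = 0" unfolding R_def g by (rule sum_grid_character_eq_0) (use pq ab in auto)
    finally have total: "sum \<psi> (carrier G) = 0" .
    have "sum g D = (\<Sum>i\<in>J. sum g (B i))" unfolding D_def
      by (rule sum.UNION_disjoint) (use J finB disjB in \<open>auto simp: disjoint_family_on_def\<close>)
    also have "\<dots> = sum g (B j) + (\<Sum>i\<in>J - {j}. sum g (B i))"
      by (rule sum.remove[OF J(1) j])
    finally have "sum g D - sum g (B j) = (\<Sum>i\<in>{1..m} - {j}. sum \<psi> (A i))"
      by (simp add: sumA J_def)
    then show ?thesis
      using SEDF_character_equation[OF A psi(1), of j] j total sumA[OF j] by (simp add: J_def)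
  qed
  have nontriv: "D \<noteq> {}" "D \<noteq> R"
  proof -
    have "A 1 \<noteq> {}" using Ak[of 1] assms(4,5) by auto
    then have "B 1 \<noteq> {}" using EB[of 1] assms(5) by (auto simp: bij_betw_def J_def)
    then show "D \<noteq> {}" using assms(5) by (auto simp: D_def J_def)
    show "D \<noteq> R"
    proof
      assume "D = R"
      then have "carrier G = E ` D" using E by (simp add: bij_betw_def)
      also have "\<dots> = (\<Union>i\<in>J. A i)" using EB by (simp add: D_def image_UN bij_betw_def)
      finally show False using SEDF_not_covering[OF A assms(4)] by (simp add: J_def)
    qed
  qed
  \<comment> \<open>Frequencies \<open>(1, 1)\<close> give a faithful character.\<close>
  have "(\<forall>x<p. \<forall>x'<p. \<forall>y<q. (x, y) \<in> D \<longleftrightarrow> (x', y) \<in> D) \<or>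
        (\<forall>x<p. \<forall>y<q. \<forall>y'<q. (x, y) \<in> D \<longleftrightarrow> (x, y') \<in> D)"
    by (rule union_independent_of_coordinate[OF assms(1-3) J lam BR disjB D_def refl])
       (rule eq[of _ 1 1], use pq in auto)
  then show False
  proof
    assume indep: "\<forall>x<p. \<forall>x'<p. \<forall>y<q. (x, y) \<in> D \<longleftrightarrow> (x', y) \<in> D"
    \<comment> \<open>Frequencies \<open>(0, 1)\<close> give a character that sees only the second
      coordinate.\<close>
    have "D = {} \<or> D = {..<p} \<times> {..<q}"
      by (rule union_trivial_if_independent_of_fst[OF assms(2) _ J lam BR disjB D_def refl _ indep])
         (use pq in simp, rule eq[of _ 0 1], use pq in auto)
    then show False using nontriv by (simp add: R_def)
  next
    assume indep: "\<forall>x<p. \<forall>y<q. \<forall>y'<q. (x, y) \<in> D \<longleftrightarrow> (x, y') \<in> D"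
    \<comment> \<open>Exchanging the coordinates, and with them \<open>p\<close> and
      \<open>q\<close>, brings this case under the same lemma.\<close>
    have swap_mem: "(y, x) \<in> prod.swap ` D \<longleftrightarrow> (x, y) \<in> D" for x y
      by (metis pair_in_swap_image)
    define B' where "B' j = prod.swap ` B j" for j
    have D': "prod.swap ` D = (\<Union>j\<in>J. B' j)" by (auto simp: D_def B'_def)
    have B'R: "B' j \<subseteq> {..<q} \<times> {..<p}" for j using BR[of j] by (auto simp: B'_def)
    have disjB': "disjoint_family_on B' J"
      unfolding disjoint_family_on_def
    proof (intro ballI impI)
      fix i j assume "i \<in> J" "j \<in> J" "i \<noteq> j"
      then have "B i \<inter> B j = {}" using disjB by (simp add: disjoint_family_on_def)
      then show "B' i \<inter> B' j = {}" by (auto simp: B'_def)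
    qed
    \<comment> \<open>The factor \<open>zeta q ^ (0 * y)\<close> is 1; it is written out to match
      \<open>eq\<close> at frequencies \<open>(1, 0)\<close>.\<close>
    have swap: "(\<Sum>z\<in>prod.swap ` X. case z of (y, x) \<Rightarrow> zeta p ^ x)
        = (\<Sum>z\<in>X. case z of (x, y) \<Rightarrow> zeta p ^ (1 * x) * zeta q ^ (0 * y))" for X :: "(nat \<times> nat) set"
      by (subst sum.reindex) (auto simp: case_prod_unfold inj_on_def)
    have "prod.swap ` D = {} \<or> prod.swap ` D = {..<q} \<times> {..<p}"
    proof (rule union_trivial_if_independent_of_fst[OF assms(1) _ J lam B'R disjB' D' refl])
      show "q > 0" using pq by simp
      show "\<forall>y<q. \<forall>y'<q. \<forall>x<p. (y, x) \<in> prod.swap ` D \<longleftrightarrow> (y', x) \<in> prod.swap ` D"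
        unfolding swap_mem using indep by blast
      fix j assume "j \<in> J"
      then show "((\<Sum>z\<in>prod.swap ` D. case z of (y, x) \<Rightarrow> zeta p ^ x)
            - (\<Sum>z\<in>B' j. case z of (y, x) \<Rightarrow> zeta p ^ x))
          * cnj (\<Sum>z\<in>B' j. case z of (y, x) \<Rightarrow> zeta p ^ x) = - complex_of_real (real l)"
        unfolding B'_def swap by (intro eq[of _ 1 0]) (use pq in auto)
    qed
    then have "D = {} \<or> D = R"
    proof
      assume "prod.swap ` D = {..<q} \<times> {..<p}"
      then have "prod.swap ` prod.swap ` D = prod.swap ` ({..<q} \<times> {..<p})" by simp
      then show ?thesis by (simp add: image_image R_def product_swap)
    qed simp
    then show False using nontriv by blast
  qed
qed

end
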